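(* For every integer $s$, \[ \sum_{n=1}^\infty \frac{F_{2n+s}}{n(n+1)C_n}=(F_{s+1}\sqrt5-F_{s-1})\frac{\pi}{5}\sqrt{\frac{\alpha^3}{\sqrt5}},\qquad \sum_{n=1}^\infty \frac{L_{2n+s}}{n(n+1)C_n}=(L_{s+1}\sqrt5-L_{s-1})\frac{\pi}{5}\sqrt{\frac{\alpha^3}{\sqrt5}}. \]
   Context: $C_n=\frac{1}{n+1}\binom{2n}{n}$ are the Catalan numbers. $\alpha=\frac{1+\sqrt5}{2}$, $\beta=\frac{1-\sqrt5}{2}$. The Fibonacci and Lucas numbers are defined for all integers $n$ by $F_n=\frac{\alpha^n-\beta^n}{\alpha-\beta}$ and $L_n=\alpha^n+\beta^n$. *)

theory Defs
  imports Complex_Main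
begin

definition golden :: real where
  "golden = (1 + sqrt 5) / 2"

definition golden_conj :: real where
  "golden_conj = (1 - sqrt 5) / 2"

definition catalan :: "nat \<Rightarrow> real" where
  "catalan n = 1 / (real n + 1) * real ((2 * n) choose n)"

definition fib_int :: "int \<Rightarrow> real" where
  "fib_int n = (golden powi n - golden_conj powi n) / (golden - golden_conj)"

definition lucas_int :: "int \<Rightarrow> real" where
  "lucas_int n = golden powi n + golden_conj powi n"

end

(*
  With y = x^2 the series H(y) = sum c_n y^n, c_n = 4^n / ((2n+1) binom(2n,n)), satisfies
  (1 - y) (H + 2 y H') = 1 + y H, because (2n+3) c_{n+1} = 2 (n+1) c_n.  Hence
  x sqrt(1 - x^2) H(x^2) and arcsin x have the same derivative, which gives
    sum_{n >= 1} (2x)^(2n) / (n binom(2n,n)) = 2 x arcsin x / sqrt(1 - x^2).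
  Since golden / 2 = sin(3 pi/10) and golden_conj / 2 = sin(-pi/10), the series at 2x = golden and
  at 2x = golden_conj are 3 K and K / golden^3 with K = (pi/5) sqrt(golden^3 / sqrt 5); the
  theorem combines these two values by the Binet formulas.
*)
theory Submission imports Defs begin

section \<open>The arcsine series\<close>

lemma central_binomial_Suc:
  "(real n + 1) * real ((2 * Suc n) choose Suc n) = 2 * (2 * real n + 1) * real ((2 * n) choose n)"
proof -
  have *: "real ((2 * m) choose m) = fact (2 * m) / (fact m)\<^sup>2" for m :: nat
    by (simp add: binomial_fact power2_eq_square)
  have fact1: "fact (2 * Suc n) = (2 * real n + 2) * (2 * real n + 1) * (fact (2 * n) :: real)"
    by (simp add: algebra_simps)
  have fact2: "(fact (Suc n) :: real) = (real n + 1) * fact n"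
    by (simp add: algebra_simps)
  have "real n + 1 \<noteq> 0"
    by linarith
  thus ?thesis
    unfolding * fact1 fact2
    by (simp add: divide_simps power2_eq_square) (simp add: algebra_simps)
qed

text \<open>For 0 < |x| < 1 these are the coefficients of arcsin x / (x sqrt(1 - x^2)) as a power
  series in x^2.\<close>

definition arcsin_coeff :: "nat \<Rightarrow> real" where
  "arcsin_coeff n = 4 ^ n / ((2 * real n + 1) * real ((2 * n) choose n))"

lemma arcsin_coeff_0 [simp]: "arcsin_coeff 0 = 1"
  by (simp add: arcsin_coeff_def)

text \<open>The central binomial coefficient grows by the factor 2(2n+1)/(n+1), whose 2n+1 cancels
  against the odd denominator of \<open>arcsin_coeff n\<close>. Clearing denominators gives a form
  that can be compared termwise in power series.\<close>

lemma arcsin_coeff_Suc: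
  "(2 * real n + 3) * arcsin_coeff (Suc n) = 2 * (real n + 1) * arcsin_coeff n"
proof -
  define A where "A = real ((2 * n) choose n)"
  define B where "B = real ((2 * Suc n) choose Suc n)"
  have pos: "A > 0" "B > 0"
    by (auto simp: A_def B_def simp del: mult_Suc_right)
  have B: "B = 2 * (2 * real n + 1) * A / (real n + 1)"
    using central_binomial_Suc[of n] unfolding A_def B_def by (simp add: field_simps)
  have "2 * real (Suc n) + 1 = 2 * real n + 3"
    by simp
  hence "(2 * real n + 3) * arcsin_coeff (Suc n) = 4 * 4 ^ n / B"
    unfolding arcsin_coeff_def B_def power_Suc by (simp only:) simp
  also have "\<dots> = 2 * (real n + 1) * (4 ^ n / ((2 * real n + 1) * A))"
  proof -
    have "4 * p / (2 * M * A / N) = 2 * N * (p / (M * A))" if "M > 0" "N > 0" for p M N :: real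
      using that pos(1) by (simp add: field_simps)
    from this [of "2 * real n + 1" "real n + 1" "4 ^ n"] show ?thesis
      unfolding B by linarith
  qed
  finally show ?thesis
    by (simp add: arcsin_coeff_def A_def)
qed

lemma arcsin_coeff_nonneg: "arcsin_coeff n \<ge> 0"
  by (simp add: arcsin_coeff_def)

text \<open>Consecutive coefficients have ratio (2n+2)/(2n+3) < 1 and start at 1. This allows
  comparison with a geometric series.\<close>

lemma arcsin_coeff_le_1: "arcsin_coeff n \<le> 1"
proof (induction n)
  case (Suc n)
  have "(2 * real n + 3) * arcsin_coeff (Suc n) \<le> 2 * (real n + 1) * 1"
    unfolding arcsin_coeff_Suc by (intro mult_left_mono Suc) auto
  also have "\<dots> \<le> (2 * real n + 3) * 1"
    by simp
  finally show ?case
    by (subst (asm) mult_le_cancel_left_pos) auto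
qed simp

lemma summable_arcsin_coeff:
  fixes y :: real
  assumes "\<bar>y\<bar> < 1"
  shows "summable (\<lambda>n. arcsin_coeff n * y ^ n)"
proof (rule summable_comparison_test')
  show "summable (\<lambda>n. \<bar>y\<bar> ^ n)"
    using assms by (intro summable_geometric) auto
  show "norm (arcsin_coeff n * y ^ n) \<le> \<bar>y\<bar> ^ n" for n
    using arcsin_coeff_le_1[of n] arcsin_coeff_nonneg[of n]
    by (simp add: abs_mult power_abs mult_left_le_one_le)
qed

definition arcsin_gf :: "real \<Rightarrow> real" where
  "arcsin_gf y = (\<Sum>n. arcsin_coeff n * y ^ n)"

text \<open>The operator H + 2 y H' multiplies the n-th coefficient by 2n+1, so the recurrence, read
  as (2n+3) c_{n+1} = (2n+1) c_n + c_n, becomes E - 1 = y E + y H.\<close>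

lemma arcsin_gf_ode:
  fixes y :: real
  assumes "\<bar>y\<bar> < 1"
  obtains D where "(arcsin_gf has_field_derivative D) (at y)"
    "(1 - y) * (arcsin_gf y + 2 * y * D) = 1 + y * arcsin_gf y"
proof
  define c where "c = arcsin_coeff"
  define D where "D = (\<Sum>n. diffs c n * y ^ n)"
  show "(arcsin_gf has_field_derivative D) (at y)"
    unfolding arcsin_gf_def [abs_def] D_def c_def
    by (rule termdiffs_strong'[where K = 1]) (use assms summable_arcsin_coeff in auto)
  have H: "(\<lambda>n. c n * y ^ n) sums arcsin_gf y"
    unfolding c_def arcsin_gf_def by (intro summable_sums summable_arcsin_coeff assms)
  have "summable (\<lambda>n. diffs c n * y ^ n)"
    by (rule termdiff_converges[where K = 1])
       (use assms summable_arcsin_coeff in \<open>auto simp: c_def\<close>)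
  hence "(\<lambda>n. diffs c n * y ^ n) sums D"
    unfolding D_def by (rule summable_sums)
  hence "(\<lambda>n. y * (diffs c n * y ^ n)) sums (y * D)"
    by (rule sums_mult)
  hence "(\<lambda>n. real (Suc n) * c (Suc n) * y ^ Suc n) sums (y * D)"
    by (simp add: diffs_def mult_ac)
  \<comment> \<open>Undoing the shift adds only the term at n = 0, which vanishes.\<close>
  hence D: "(\<lambda>n. real n * c n * y ^ n) sums (y * D)"
    by (subst (asm) sums_Suc_iff) simp
  define E where "E = arcsin_gf y + 2 * y * D"
  have E: "(\<lambda>n. (2 * real n + 1) * c n * y ^ n) sums E"
    using sums_add[OF H sums_mult[OF D, of 2]] by (simp add: E_def algebra_simps)
  \<comment> \<open>Here the dropped term at n = 0 is c_0 = 1.\<close>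
  hence "(\<lambda>n. (2 * real (Suc n) + 1) * c (Suc n) * y ^ Suc n) sums (E - 1)"
    by (subst sums_Suc_iff) (simp add: c_def)
  moreover have "(2 * real (Suc n) + 1) * c (Suc n) = (2 * real n + 2) * c n" for n
    using arcsin_coeff_Suc[of n] by (simp add: c_def algebra_simps)
  ultimately have "(\<lambda>n. (2 * real n + 2) * c n * y ^ Suc n) sums (E - 1)"
    by (simp only:)
  hence "(\<lambda>n. (2 * real n + 2) * c n * y ^ Suc n - y * ((2 * real n + 1) * c n * y ^ n))
           sums (E - 1 - y * E)"
    by (intro sums_diff sums_mult E)
  hence "(\<lambda>n. y * (c n * y ^ n)) sums (E - 1 - y * E)"
    by (simp add: algebra_simps)
  with sums_mult[OF H, of y] have "E - 1 - y * E = y * arcsin_gf y"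
    by (rule sums_unique2[symmetric])
  thus "(1 - y) * (arcsin_gf y + 2 * y * D) = 1 + y * arcsin_gf y"
    unfolding E_def [symmetric] left_diff_distrib mult_1_left by linarith
qed

lemma arcsin_gf_eq:
  fixes x :: real
  assumes "\<bar>x\<bar> < 1"
  shows "x * sqrt (1 - x\<^sup>2) * arcsin_gf (x\<^sup>2) = arcsin x"
proof -
  define P where "P x = x * sqrt (1 - x\<^sup>2) * arcsin_gf (x\<^sup>2) - arcsin x" for x
  have "P x = P 0"
  proof (rule DERIV_isconst3 [where f = P and a = "-1" and b = 1])
    fix x :: real assume "x \<in> {-1<..<1}"
    hence x: "-1 < x" "x < 1" "x\<^sup>2 < 1"
      by (auto simp: abs_square_less_1)
    obtain D where D: "(arcsin_gf has_field_derivative D) (at (x\<^sup>2))"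
      "(1 - x\<^sup>2) * (arcsin_gf (x\<^sup>2) + 2 * x\<^sup>2 * D) = 1 + x\<^sup>2 * arcsin_gf (x\<^sup>2)"
      using arcsin_gf_ode[of "x\<^sup>2"] x by auto
    define r where "r = sqrt (1 - x\<^sup>2)"
    have r: "r > 0" "r\<^sup>2 = 1 - x\<^sup>2"
      using x by (auto simp: r_def)
    have *: "((\<lambda>x. arcsin_gf (x\<^sup>2)) has_field_derivative D * (2 * x)) (at x)"
      by (rule DERIV_chain2 [where f = arcsin_gf and g = "\<lambda>x. x\<^sup>2", OF D(1)])
         (auto intro!: derivative_eq_intros)
    have sq: "((\<lambda>x. sqrt (1 - x\<^sup>2)) has_field_derivative - x / r) (at x)"
      using x by (auto intro!: derivative_eq_intros simp: r_def field_simps)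
    have "(P has_field_derivative
        (r + x * (- x / r)) * arcsin_gf (x\<^sup>2) + x * r * (D * (2 * x)) - 1 / r) (at x)"
      unfolding P_def [abs_def]
      by (rule DERIV_cong
            [OF DERIV_diff [OF DERIV_mult [OF DERIV_mult [OF DERIV_ident sq] *] DERIV_arcsin [OF x(1,2)]]])
         (simp add: r_def divide_inverse algebra_simps)
    \<comment> \<open>Since r^2 = 1 - x^2, the numerator is the difference of the two sides of the
      differential equation at y = x^2.\<close>
    moreover have "(r + x * (- x / r)) * arcsin_gf (x\<^sup>2) + x * r * (D * (2 * x)) - 1 / r
        = (r\<^sup>2 * (arcsin_gf (x\<^sup>2) + 2 * x\<^sup>2 * D) - (1 + x\<^sup>2 * arcsin_gf (x\<^sup>2))) / r"
      using r(1) by (simp add: field_simps power2_eq_square)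
    ultimately show "(P has_field_derivative 0) (at x)"
      using D(2) by (simp add: r(2))
  qed (use assms in auto)
  thus ?thesis
    by (simp add: P_def)
qed

lemma central_binomial_series_sums:
  fixes x :: real
  assumes "\<bar>x\<bar> < 1"
  shows "(\<lambda>k. (2 * x) ^ (2 * Suc k) / (real (Suc k) * real ((2 * Suc k) choose Suc k)))
           sums (2 * x * arcsin x / sqrt (1 - x\<^sup>2))"
proof -
  have x2: "x\<^sup>2 < 1"
    using assms by (simp add: abs_square_less_1)
  have "(\<lambda>k. arcsin_coeff k * (x\<^sup>2) ^ k) sums arcsin_gf (x\<^sup>2)"
    unfolding arcsin_gf_def using x2 by (intro summable_sums summable_arcsin_coeff) auto
  hence "(\<lambda>k. 2 * x\<^sup>2 * (arcsin_coeff k * (x\<^sup>2) ^ k)) sums (2 * x\<^sup>2 * arcsin_gf (x\<^sup>2))"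
    by (rule sums_mult)
  \<comment> \<open>Substituting for arcsin x avoids dividing by x, so x = 0 is covered.\<close>
  moreover have "2 * x\<^sup>2 * arcsin_gf (x\<^sup>2) = 2 * x * arcsin x / sqrt (1 - x\<^sup>2)"
    using x2 by (simp add: arcsin_gf_eq[OF assms, symmetric] power2_eq_square)
  moreover have "2 * x\<^sup>2 * (arcsin_coeff k * (x\<^sup>2) ^ k)
      = (2 * x) ^ (2 * Suc k) / (real (Suc k) * real ((2 * Suc k) choose Suc k))" for k
  proof -
    have "(2 * x) ^ (2 * Suc k) = 4 * x\<^sup>2 * (4 ^ k * (x\<^sup>2) ^ k)"
      by (simp only: power_mult power_mult_distrib) simp
    moreover have "real (Suc k) * real ((2 * Suc k) choose Suc k)
        = 2 * ((2 * real k + 1) * real ((2 * k) choose k))"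
      using central_binomial_Suc[of k] by (simp add: add.commute del: mult_Suc_right)
    ultimately show ?thesis
      by (simp only: arcsin_coeff_def) simp
  qed
  ultimately show ?thesis
    by simp
qed

section \<open>The values at the golden ratio and its conjugate\<close>

lemma sqrt5_bounds: "2 < sqrt 5" "sqrt 5 < 3"
  by (auto intro: real_less_rsqrt real_less_lsqrt)

lemma sqrt5_mult_self: "sqrt 5 * sqrt 5 = (5 :: real)"
  by simp

lemma golden_sq: "golden\<^sup>2 = golden + 1"
  using sqrt5_mult_self by (simp add: golden_def power2_eq_square field_simps)

lemma golden_conj_sq: "golden_conj\<^sup>2 = golden_conj + 1"
  using sqrt5_mult_self by (simp add: golden_conj_def power2_eq_square field_simps)

lemma golden_cube: "golden ^ 3 = 2 + sqrt 5"
proof -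
  have "golden ^ 3 = golden * golden\<^sup>2"
    by (simp add: power3_eq_cube power2_eq_square)
  also have "\<dots> = golden\<^sup>2 + golden"
    unfolding golden_sq by (simp add: power2_eq_square [symmetric] golden_sq algebra_simps)
  also have "\<dots> = 2 + sqrt 5"
    unfolding golden_sq by (simp add: golden_def field_simps)
  finally show ?thesis .
qed

text \<open>For t = pi/10 the angles 2t and 3t are complementary, so sin 2t = cos 3t. Cancelling cos
  t > 0 leaves the quadratic 4 s^2 + 2 s = 1 for s = sin t.\<close>

lemma sin_pi_tenth: "sin (pi / 10) = (sqrt 5 - 1) / 4"
proof -
  define s where "s = sin (pi / 10)"
  define c where "c = cos (pi / 10)"
  have s: "s > 0" and c: "c > 0"
    by (auto simp: s_def c_def intro!: sin_gt_zero cos_gt_zero)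
  have sc: "c\<^sup>2 = 1 - s\<^sup>2"
    by (simp add: c_def s_def cos_squared_eq)
  have "sin (2 * (pi / 10)) = cos (3 * (pi / 10))"
    by (simp add: sin_cos_eq field_simps)
  hence "2 * s * c = 4 * c ^ 3 - 3 * c"
    unfolding sin_double cos_treble_cos s_def c_def .
  hence "c * (2 * s) = c * (4 * c\<^sup>2 - 3)"
    by (simp add: power3_eq_cube power2_eq_square algebra_simps)
  hence "2 * s = 4 * c\<^sup>2 - 3"
    using c by simp
  hence "(4 * s + 1)\<^sup>2 = 5"
    unfolding sc by (simp add: power2_eq_square algebra_simps)
  \<comment> \<open>Positivity of s selects the root.\<close>
  hence "4 * s + 1 = sqrt 5"
    using s by (metis add_nonneg_nonneg less_eq_real_def mult_nonneg_nonneg real_sqrt_unique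
        zero_le_numeral zero_le_one)
  thus ?thesis
    by (simp add: s_def)
qed

lemma cos_pi_fifth: "cos (pi / 5) = (1 + sqrt 5) / 4"
proof -
  have "cos (pi / 5) = 1 - 2 * (sin (pi / 10))\<^sup>2"
    using cos_double_sin[of "pi / 10"] by simp
  also have "\<dots> = (1 + sqrt 5) / 4"
    using sqrt5_mult_self unfolding sin_pi_tenth by (simp add: power2_eq_square field_simps)
  finally show ?thesis .
qed

text \<open>golden/2 = cos(pi/5), and the complement of pi/5 is 3 pi/10, which lies in the range of
  arcsin.\<close>

lemma arcsin_golden: "arcsin (golden / 2) = 3 * pi / 10"
proof -
  have "sin (3 * pi / 10) = golden / 2"
    using cos_pi_fifth by (simp add: sin_cos_eq golden_def field_simps)
  thus ?thesis
    by (rule arcsin_unique [rotated 2]) (use pi_gt_zero in linarith)+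
qed

lemma arcsin_golden_conj: "arcsin (golden_conj / 2) = - (pi / 10)"
proof -
  have "sin (- (pi / 10)) = golden_conj / 2"
    by (simp add: sin_pi_tenth golden_conj_def field_simps)
  thus ?thesis
    by (rule arcsin_unique [rotated 2]) (use pi_gt_zero in linarith)+
qed

lemma golden_value:
  "2 * (golden / 2) * arcsin (golden / 2) / sqrt (1 - (golden / 2)\<^sup>2)
     = 3 * (pi / 5 * sqrt (golden ^ 3 / sqrt 5))"
proof -
  have pos: "golden > 0"
    using sqrt5_bounds by (simp add: golden_def)
  \<comment> \<open>In this form the square root yields a factor golden/2 that cancels the one in
    the numerator and leaves exactly the radical of the theorem.\<close>
  have "1 - (golden / 2)\<^sup>2 = (golden / 2)\<^sup>2 / (golden ^ 3 / sqrt 5)"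
  proof -
    have "sqrt 5 = golden * (3 - golden)"
      using golden_sq by (simp add: golden_def power2_eq_square field_simps)
    hence "1 - (golden / 2)\<^sup>2 = sqrt 5 / (4 * golden)"
      using pos by (simp add: golden_sq power_divide field_simps)
    also have "\<dots> = (golden / 2)\<^sup>2 / (golden ^ 3 / sqrt 5)"
      using pos by (simp add: power2_eq_square power3_eq_cube)
    finally show ?thesis .
  qed
  hence "sqrt (1 - (golden / 2)\<^sup>2) = (golden / 2) / sqrt (golden ^ 3 / sqrt 5)"
    using pos by (simp only: real_sqrt_divide [of "_\<^sup>2"] real_sqrt_abs)
  thus ?thesis
    using pos unfolding arcsin_golden by (simp only:) simp
qed

lemma golden_conj_value:
  "2 * (golden_conj / 2) * arcsin (golden_conj / 2) / sqrt (1 - (golden_conj / 2)\<^sup>2)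
     = (sqrt 5 - 2) * (pi / 5 * sqrt (golden ^ 3 / sqrt 5))"
proof -
  have pos: "golden > 0" and neg: "golden_conj < 0"
    using sqrt5_bounds by (auto simp: golden_def golden_conj_def)
  have r: "1 - (golden_conj / 2)\<^sup>2 = sqrt 5 * golden / 4"
    using sqrt5_mult_self
    by (simp add: golden_conj_sq power_divide) (simp add: golden_def golden_conj_def field_simps)
  have g: "- golden_conj * golden = 1"
    using sqrt5_mult_self by (simp add: golden_def golden_conj_def field_simps)
  \<comment> \<open>Thus the factor \<open>sqrt 5 - 2\<close> in the claim is the reciprocal of
    golden^3.\<close>
  have k: "(sqrt 5 - 2) * golden ^ 3 = 1"
    using sqrt5_mult_self by (simp add: golden_cube algebra_simps)
  have "sqrt (golden ^ 3 / sqrt 5) * sqrt (sqrt 5 * golden) = golden\<^sup>2"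
  proof -
    have "golden ^ 3 / sqrt 5 * (sqrt 5 * golden) = (golden\<^sup>2)\<^sup>2"
      by (simp add: power2_eq_square power3_eq_cube)
    thus ?thesis
      by (simp only: real_sqrt_mult [symmetric] real_sqrt_abs) simp
  qed
  \<comment> \<open>The two radicals multiply to golden^2, and the extra factor golden completes the
    cube. It is then removed through 1/golden = -golden_conj.\<close>
  hence "(sqrt 5 - 2) * sqrt (golden ^ 3 / sqrt 5) * sqrt (sqrt 5 * golden) * golden = 1"
    using k by (simp add: power3_eq_cube power2_eq_square mult.assoc)
  hence "(sqrt 5 - 2) * sqrt (golden ^ 3 / sqrt 5) * sqrt (sqrt 5 * golden) = - golden_conj"
    using g pos by (metis mult_right_cancel less_irrefl)
  moreover have "sqrt (sqrt 5 * golden) > 0"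
    using pos by simp
  ultimately have "(sqrt 5 - 2) * sqrt (golden ^ 3 / sqrt 5)
      = - golden_conj / sqrt (sqrt 5 * golden)"
    by (subst eq_divide_eq) simp
  moreover have "sqrt (sqrt 5 * golden / 4) = sqrt (sqrt 5 * golden) / 2"
    by (simp add: real_sqrt_divide)
  ultimately show ?thesis
    unfolding r arcsin_golden_conj mult.left_commute[of _ "pi / 5"] by (simp only:) simp
qed

text \<open>(n+1) C_n is the central binomial coefficient, so this is the previous series at x = z/2
  times z^s. Splitting off z^s for negative s requires z nonzero. Keeping the value \<open>v\<close>
  abstract lets both roots be inserted.\<close>

lemma power_catalan_series_sums:
  fixes z :: real and s :: int
  assumes "z \<noteq> 0" "\<bar>z\<bar> < 2"
    and "2 * (z / 2) * arcsin (z / 2) / sqrt (1 - (z / 2)\<^sup>2) = v"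
  shows "(\<lambda>k. z powi (2 * int (Suc k) + s) / (real (Suc k) * (real (Suc k) + 1) * catalan (Suc k)))
           sums (z powi s * v)"
proof -
  have "(\<lambda>k. z powi s * ((2 * (z / 2)) ^ (2 * Suc k) /
          (real (Suc k) * real ((2 * Suc k) choose Suc k)))) sums (z powi s * v)"
    unfolding assms(3)[symmetric]
    by (intro sums_mult central_binomial_series_sums) (use assms in auto)
  moreover have "z powi (2 * int (Suc k) + s) = z powi s * (2 * (z / 2)) ^ (2 * Suc k)" for k
  proof -
    have "z powi (2 * int (Suc k) + s) = z powi int (2 * Suc k) * z powi s"
      using assms(1) by (subst power_int_add [symmetric]) simp_all
    thus ?thesis
      unfolding power_int_of_nat by simp
  qed
  moreover have "(real (Suc k) + 1) * catalan (Suc k) = real ((2 * Suc k) choose Suc k)" for k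
    unfolding catalan_def by (simp add: field_simps del: mult_Suc_right)
  ultimately show ?thesis
    by (simp only: times_divide_eq_right mult.assoc)
qed

theorem theorem6:
  fixes s :: int
  shows "(\<lambda>k. let n = Suc k in fib_int (2 * int n + s) / (real n * (real n + 1) * catalan n))
           sums ((fib_int (s + 1) * sqrt 5 - fib_int (s - 1)) * (pi / 5) * sqrt (golden ^ 3 / sqrt 5))
       \<and> (\<lambda>k. let n = Suc k in lucas_int (2 * int n + s) / (real n * (real n + 1) * catalan n))
           sums ((lucas_int (s + 1) * sqrt 5 - lucas_int (s - 1)) * (pi / 5) * sqrt (golden ^ 3 / sqrt 5))"
proof -
  define K where "K = pi / 5 * sqrt (golden ^ 3 / sqrt 5)"
  define d where "d k = real (Suc k) * (real (Suc k) + 1) * catalan (Suc k)" for k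
  have nz: "golden \<noteq> 0" "golden_conj \<noteq> 0" and lt: "\<bar>golden\<bar> < 2" "\<bar>golden_conj\<bar> < 2"
    using sqrt5_bounds by (auto simp: golden_def golden_conj_def)
  have A: "(\<lambda>k. golden powi (2 * int (Suc k) + s) / d k) sums (golden powi s * (3 * K))"
    unfolding d_def K_def by (rule power_catalan_series_sums[OF nz(1) lt(1) golden_value])
  have B: "(\<lambda>k. golden_conj powi (2 * int (Suc k) + s) / d k)
      sums (golden_conj powi s * ((sqrt 5 - 2) * K))"
    unfolding d_def K_def by (rule power_catalan_series_sums[OF nz(2) lt(2) golden_conj_value])
  \<comment> \<open>The combination on the right of the theorem acts on z^s as multiplication by z
    sqrt 5 - 1/z. At the two roots this factor is 3 and sqrt 5 - 2, the multiples of
    \<open>K\<close> found for the two series.\<close>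
  have powi_step: "z powi (s + 1) * sqrt 5 - z powi (s - 1) = z powi s * (z * sqrt 5 - 1 / z)"
    if "z \<noteq> 0" for z
    using that by (simp add: power_int_add power_int_diff right_diff_distrib mult.assoc)
  have "golden * sqrt 5 - 1 / golden = 3"
    using nz(1) golden_sq sqrt5_mult_self
    by (simp add: field_simps power2_eq_square) (simp add: golden_def field_simps)
  hence gs: "golden powi (s + 1) * sqrt 5 - golden powi (s - 1) = golden powi s * 3"
    using powi_step [OF nz(1)] by simp
  have "golden_conj * sqrt 5 - 1 / golden_conj = sqrt 5 - 2"
    using nz(2) golden_conj_sq sqrt5_mult_self
    by (simp add: field_simps power2_eq_square) (simp add: golden_conj_def field_simps)
  hence cs: "golden_conj powi (s + 1) * sqrt 5 - golden_conj powi (s - 1)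
      = golden_conj powi s * (sqrt 5 - 2)"
    using powi_step [OF nz(2)] by simp
  \<comment> \<open>By linearity of the Binet formula, the claimed value splits into the sums in
    \<open>A\<close> and \<open>B\<close>.\<close>
  have F: "(fib_int (s + 1) * sqrt 5 - fib_int (s - 1)) * K
      = (golden powi s * (3 * K) - golden_conj powi s * ((sqrt 5 - 2) * K)) / (golden - golden_conj)"
  proof -
    have "fib_int (s + 1) * sqrt 5 - fib_int (s - 1)
      = ((golden powi (s + 1) * sqrt 5 - golden powi (s - 1))
         - (golden_conj powi (s + 1) * sqrt 5 - golden_conj powi (s - 1))) / (golden - golden_conj)"
      unfolding fib_int_def by (simp only: times_divide_eq_left left_diff_distrib flip: diff_divide_distrib) simp
    thus ?thesis
      unfolding gs cs by (simp add: algebra_simps)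
  qed
  have L: "(lucas_int (s + 1) * sqrt 5 - lucas_int (s - 1)) * K
      = golden powi s * (3 * K) + golden_conj powi s * ((sqrt 5 - 2) * K)"
  proof -
    have "lucas_int (s + 1) * sqrt 5 - lucas_int (s - 1)
      = (golden powi (s + 1) * sqrt 5 - golden powi (s - 1))
         + (golden_conj powi (s + 1) * sqrt 5 - golden_conj powi (s - 1))"
      unfolding lucas_int_def by (simp add: algebra_simps)
    thus ?thesis
      unfolding gs cs by (simp only: distrib_right mult.assoc)
  qed
  have "(\<lambda>k. fib_int (2 * int (Suc k) + s) / d k)
      sums ((fib_int (s + 1) * sqrt 5 - fib_int (s - 1)) * K)"
    unfolding F unfolding fib_int_def using sums_divide[OF sums_diff[OF A B], of "golden - golden_conj"]
    by (simp add: diff_divide_distrib divide_divide_eq_left mult.commute)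
  moreover have "(\<lambda>k. lucas_int (2 * int (Suc k) + s) / d k)
      sums ((lucas_int (s + 1) * sqrt 5 - lucas_int (s - 1)) * K)"
    unfolding L unfolding lucas_int_def using sums_add[OF A B] by (simp add: add_divide_distrib)
  ultimately show ?thesis
    unfolding K_def d_def Let_def by (simp only: mult.assoc)
qed

end
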